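(* Let $K$ be an arbitrary wedge in $L^0$ and let $\emptyset\neq M\subseteq M_1=M_1(\mathbb P;K)$. Put $c_E(K):=\overline{s_E(K)}^{\sigma(E,F)}$. Then the following statements are equivalent: (i) $\overline{\mathcal W(R(M))}^{\sigma(F,E)}=F\cap\mathcal W(R(M_1))$; (ii) $R(M)^\lhd=c_E(K)$; (iii) $\overline{\mathcal W(R(M))}^{\sigma(F,E)}=(c_E(K))^\lhd=s_E(K)^\lhd$.
   Context: $(\Omega,\mathcal F,\mathbb P)$ is a probability space and $L^0=L^0(\Omega,\mathcal F,\mathbb P)$ is the vector lattice of real random variables modulo $\mathbb P$-a.s. equality, ordered $\mathbb P$-a.s. For a probability measure $\mathbb Q\ll\mathbb P$, $L^1(\mathbb Q)$ is regarded as the set of $X\in L^0$ with $\mathbb E_{\mathbb Q}|X|<\infty$. A wedge in a real vector space is a non-empty convex set $C$ with $\lambda C\subseteq C$ for all $\lambda\ge0$. $\mathcal W(S)$ is the smallest wedge containing the non-empty set $S$, and $[S]$ is the linear span of $S$. $M_1=M_1(\mathbb P;K)$ is the set of all probability measures $\mathbb Q\ll\mathbb P$ such that $K\subseteq L^1(\mathbb Q)$ and $\mathbb E_{\mathbb Q}[X]\le0$ for all $X\in K$. $R(\mathbb Q):=\frac{d\mathbb Q}{d\mathbb P}\in L^1(\mathbb P)$ for every probability measure $\mathbb Q\ll\mathbb P$. For non-empty $M\subseteq M_1$ put $E:=\bigcap_{\mathbb Q\in M}L^1(\mathbb Q)$ (a vector sublattice of $L^0$ containing $K$) and $F:=[R(M)]\subseteq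 L^1(\mathbb P)$, with bilinear form $\langle z,w\rangle:=\mathbb E_{\mathbb P}[zw]$ on $E\times F$. $\sigma(E,F)$ and $\sigma(F,E)$ are the associated weak topologies (not necessarily Hausdorff). Polar wedges are taken with respect to this bilinear system: for non-empty $A\subseteq E$, $A^\lhd=\{w\in F:\langle z,w\rangle\le0\ \forall z\in A\}$; for non-empty $B\subseteq F$, $B^\lhd=\{z\in E:\langle z,w\rangle\le0\ \forall w\in B\}$. $s_E(K):=K-E_+=\{x\in E:x\le g\text{ for some }g\in K\}$, where $E_+=\{x\in E:x\ge0\}$. *)

theory Defs
  imports "HOL-Probability.Probability"
begin

(* The space L^0(P) of random variables modulo P-a.s. equality is a set of equivalence
   classes, so an element of L^0 has type ('a => real) set.  Operations on classes are
   computed on a chosen representative; the lemmas below show that they do not depend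
   on the choice. *)

definition ae_rel :: "'a measure \<Rightarrow> (('a \<Rightarrow> real) \<times> ('a \<Rightarrow> real)) set" where
  "ae_rel P = {(X, Y). X \<in> borel_measurable P \<and> Y \<in> borel_measurable P \<and> (AE \<omega> in P. X \<omega> = Y \<omega>)}"

definition L0 :: "'a measure \<Rightarrow> ('a \<Rightarrow> real) set set" where
  "L0 P = borel_measurable P // ae_rel P"

definition cls :: "'a measure \<Rightarrow> ('a \<Rightarrow> real) \<Rightarrow> ('a \<Rightarrow> real) set" where
  "cls P X = ae_rel P `` {X}"

definition rep :: "('a \<Rightarrow> real) set \<Rightarrow> 'a \<Rightarrow> real" where
  "rep x = (SOME X. X \<in> x)"

definition L0_add :: "'a measure \<Rightarrow> ('a \<Rightarrow> real) set \<Rightarrow> ('a \<Rightarrow> real) set \<Rightarrow> ('a \<Rightarrow> real) set" where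
  "L0_add P x y = cls P (\<lambda>\<omega>. rep x \<omega> + rep y \<omega>)"

definition L0_diff :: "'a measure \<Rightarrow> ('a \<Rightarrow> real) set \<Rightarrow> ('a \<Rightarrow> real) set \<Rightarrow> ('a \<Rightarrow> real) set" where
  "L0_diff P x y = cls P (\<lambda>\<omega>. rep x \<omega> - rep y \<omega>)"

definition L0_scale :: "'a measure \<Rightarrow> real \<Rightarrow> ('a \<Rightarrow> real) set \<Rightarrow> ('a \<Rightarrow> real) set" where
  "L0_scale P c x = cls P (\<lambda>\<omega>. c * rep x \<omega>)"

definition L0_zero :: "'a measure \<Rightarrow> ('a \<Rightarrow> real) set" where
  "L0_zero P = cls P (\<lambda>\<omega>. 0)"

definition L0_le :: "'a measure \<Rightarrow> ('a \<Rightarrow> real) set \<Rightarrow> ('a \<Rightarrow> real) set \<Rightarrow> bool" where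
  "L0_le P x y \<longleftrightarrow> (AE \<omega> in P. rep x \<omega> \<le> rep y \<omega>)"


definition wedge :: "'a measure \<Rightarrow> ('a \<Rightarrow> real) set set \<Rightarrow> bool" where
  "wedge P C \<longleftrightarrow> C \<subseteq> L0 P \<and> C \<noteq> {} \<and>
     (\<forall>x\<in>C. \<forall>y\<in>C. \<forall>t. 0 \<le> t \<and> t \<le> 1 \<longrightarrow> L0_add P (L0_scale P t x) (L0_scale P (1 - t) y) \<in> C) \<and>
     (\<forall>x\<in>C. \<forall>c\<ge>0. L0_scale P c x \<in> C)"

definition wedge_hull :: "'a measure \<Rightarrow> ('a \<Rightarrow> real) set set \<Rightarrow> ('a \<Rightarrow> real) set set" where
  "wedge_hull P S = \<Inter>{C. wedge P C \<and> S \<subseteq> C}"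

definition lin_subspace :: "'a measure \<Rightarrow> ('a \<Rightarrow> real) set set \<Rightarrow> bool" where
  "lin_subspace P V \<longleftrightarrow> V \<subseteq> L0 P \<and> L0_zero P \<in> V \<and>
     (\<forall>x\<in>V. \<forall>y\<in>V. L0_add P x y \<in> V) \<and> (\<forall>x\<in>V. \<forall>c. L0_scale P c x \<in> V)"

definition lin_span :: "'a measure \<Rightarrow> ('a \<Rightarrow> real) set set \<Rightarrow> ('a \<Rightarrow> real) set set" where
  "lin_span P S = \<Inter>{V. lin_subspace P V \<and> S \<subseteq> V}"


definition ac_prob :: "'a measure \<Rightarrow> 'a measure \<Rightarrow> bool" where
  "ac_prob P Q \<longleftrightarrow> prob_space Q \<and> sets Q = sets P \<and> absolutely_continuous P Q"

definition L1 :: "'a measure \<Rightarrow> 'a measure \<Rightarrow> ('a \<Rightarrow> real) set set" where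
  "L1 P Q = {x \<in> L0 P. integrable Q (rep x)}"

definition M1 :: "'a measure \<Rightarrow> ('a \<Rightarrow> real) set set \<Rightarrow> 'a measure set" where
  "M1 P K = {Q. ac_prob P Q \<and> K \<subseteq> L1 P Q \<and> (\<forall>x\<in>K. (\<integral>\<omega>. rep x \<omega> \<partial>Q) \<le> 0)}"

definition RN_class :: "'a measure \<Rightarrow> 'a measure \<Rightarrow> ('a \<Rightarrow> real) set" where
  "RN_class P Q = cls P (\<lambda>\<omega>. enn2real (RN_deriv P Q \<omega>))"

definition E_space :: "'a measure \<Rightarrow> 'a measure set \<Rightarrow> ('a \<Rightarrow> real) set set" where
  "E_space P M = (\<Inter>Q\<in>M. L1 P Q)"

definition F_space :: "'a measure \<Rightarrow> 'a measure set \<Rightarrow> ('a \<Rightarrow> real) set set" where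
  "F_space P M = lin_span P (RN_class P ` M)"

definition pairing :: "'a measure \<Rightarrow> ('a \<Rightarrow> real) set \<Rightarrow> ('a \<Rightarrow> real) set \<Rightarrow> real" where
  "pairing P z w = (\<integral>\<omega>. rep z \<omega> * rep w \<omega> \<partial>P)"


(* The coarsest topology on X making every functional (%x. b x y), y in Y, continuous. *)
definition weak_topology :: "'x set \<Rightarrow> 'y set \<Rightarrow> ('x \<Rightarrow> 'y \<Rightarrow> real) \<Rightarrow> 'x topology" where
  "weak_topology X Y b = topology_generated_by {{x \<in> X. b x y \<in> U} | y U. y \<in> Y \<and> open U}"

definition sigma_EF :: "'a measure \<Rightarrow> 'a measure set \<Rightarrow> ('a \<Rightarrow> real) set topology" where
  "sigma_EF P M = weak_topology (E_space P M) (F_space P M) (\<lambda>z w. pairing P z w)"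

definition sigma_FE :: "'a measure \<Rightarrow> 'a measure set \<Rightarrow> ('a \<Rightarrow> real) set topology" where
  "sigma_FE P M = weak_topology (F_space P M) (E_space P M) (\<lambda>w z. pairing P z w)"

definition polar_F :: "'a measure \<Rightarrow> 'a measure set \<Rightarrow> ('a \<Rightarrow> real) set set \<Rightarrow> ('a \<Rightarrow> real) set set" where
  "polar_F P M A = {w \<in> F_space P M. \<forall>z\<in>A. pairing P z w \<le> 0}"

definition polar_E :: "'a measure \<Rightarrow> 'a measure set \<Rightarrow> ('a \<Rightarrow> real) set set \<Rightarrow> ('a \<Rightarrow> real) set set" where
  "polar_E P M B = {z \<in> E_space P M. \<forall>w\<in>B. pairing P z w \<le> 0}"

definition E_pos :: "'a measure \<Rightarrow> 'a measure set \<Rightarrow> ('a \<Rightarrow> real) set set" where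
  "E_pos P M = {x \<in> E_space P M. L0_le P (L0_zero P) x}"

definition s_E :: "'a measure \<Rightarrow> 'a measure set \<Rightarrow> ('a \<Rightarrow> real) set set \<Rightarrow> ('a \<Rightarrow> real) set set" where
  "s_E P M K = {L0_diff P g h | g h. g \<in> K \<and> h \<in> E_pos P M}"

definition c_E :: "'a measure \<Rightarrow> 'a measure set \<Rightarrow> ('a \<Rightarrow> real) set set \<Rightarrow> ('a \<Rightarrow> real) set set" where
  "c_E P M K = sigma_EF P M closure_of s_E P M K"


lemma equiv_ae_rel: "equiv (borel_measurable P) (ae_rel P)"
proof (rule equivI)
  show "trans (ae_rel P)"
    unfolding trans_def
  proof safe
    fix X Y Z assume "(X, Y) \<in> ae_rel P" "(Y, Z) \<in> ae_rel P"
    then show "(X, Z) \<in> ae_rel P"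
      unfolding ae_rel_def by (auto elim: AE_mp)
  qed
  show "sym (ae_rel P)"
    unfolding sym_def ae_rel_def by (auto elim: AE_mp)
qed (auto simp: refl_on_def ae_rel_def)

lemma cls_eq_iff:
  "X \<in> borel_measurable P \<Longrightarrow> Y \<in> borel_measurable P \<Longrightarrow>
    cls P X = cls P Y \<longleftrightarrow> (AE \<omega> in P. X \<omega> = Y \<omega>)"
  unfolding cls_def using eq_equiv_class_iff[OF equiv_ae_rel, of X P Y] by (auto simp: ae_rel_def)

lemma cls_in_L0: "X \<in> borel_measurable P \<Longrightarrow> cls P X \<in> L0 P"
  unfolding cls_def L0_def by (rule quotientI)

lemma rep_L0:
  assumes "x \<in> L0 P"
  shows "rep x \<in> borel_measurable P" "cls P (rep x) = x"
proof -
  from assms obtain X where X: "X \<in> borel_measurable P" "x = ae_rel P `` {X}"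
    unfolding L0_def by (auto elim: quotientE)
  then have "X \<in> x" by (auto simp: ae_rel_def)
  then have "rep x \<in> x" unfolding rep_def by (rule someI[where P="\<lambda>X. X \<in> x"])
  with X have r: "(X, rep x) \<in> ae_rel P" by auto
  then show "rep x \<in> borel_measurable P" by (simp add: ae_rel_def)
  show "cls P (rep x) = x"
    unfolding cls_def X(2) using equiv_class_eq[OF equiv_ae_rel r] X(2) by simp
qed

lemma rep_cls:
  assumes "X \<in> borel_measurable P"
  shows "AE \<omega> in P. rep (cls P X) \<omega> = X \<omega>"
  using assms rep_L0[OF cls_in_L0[OF assms]] cls_eq_iff by blast

lemma L0_add_cls:
  assumes [measurable]: "X \<in> borel_measurable P" "Y \<in> borel_measurable P"
  shows "L0_add P (cls P X) (cls P Y) = cls P (\<lambda>\<omega>. X \<omega> + Y \<omega>)"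
proof -
  note [measurable] = rep_L0(1)[OF cls_in_L0]
  show ?thesis unfolding L0_add_def
    using rep_cls[OF assms(1)] rep_cls[OF assms(2)] by (subst cls_eq_iff) auto
qed

lemma L0_diff_cls:
  assumes [measurable]: "X \<in> borel_measurable P" "Y \<in> borel_measurable P"
  shows "L0_diff P (cls P X) (cls P Y) = cls P (\<lambda>\<omega>. X \<omega> - Y \<omega>)"
proof -
  note [measurable] = rep_L0(1)[OF cls_in_L0]
  show ?thesis unfolding L0_diff_def
    using rep_cls[OF assms(1)] rep_cls[OF assms(2)] by (subst cls_eq_iff) auto
qed

lemma L0_scale_cls:
  assumes [measurable]: "X \<in> borel_measurable P"
  shows "L0_scale P c (cls P X) = cls P (\<lambda>\<omega>. c * X \<omega>)"
proof -
  note [measurable] = rep_L0(1)[OF cls_in_L0]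
  show ?thesis unfolding L0_scale_def
    using rep_cls[OF assms(1)] by (subst cls_eq_iff) auto
qed

lemma L0_le_cls:
  assumes "X \<in> borel_measurable P" "Y \<in> borel_measurable P"
  shows "L0_le P (cls P X) (cls P Y) \<longleftrightarrow> (AE \<omega> in P. X \<omega> \<le> Y \<omega>)"
proof -
  have "AE \<omega> in P. (rep (cls P X) \<omega> \<le> rep (cls P Y) \<omega>) = (X \<omega> \<le> Y \<omega>)"
    using rep_cls[OF assms(1)] rep_cls[OF assms(2)] by auto
  then show ?thesis unfolding L0_le_def by (auto elim: AE_mp)
qed

lemma topspace_weak_topology:
  assumes "Y \<noteq> {}"
  shows "topspace (weak_topology X Y b) = X"
  using assms unfolding weak_topology_def topology_generated_by_topspace by auto

lemma L1_class:
  assumes Q: "ac_prob P Q" and X: "X \<in> borel_measurable P"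
  shows "cls P X \<in> L1 P Q \<longleftrightarrow> integrable Q X"
    and "(\<integral>\<omega>. rep (cls P X) \<omega> \<partial>Q) = (\<integral>\<omega>. X \<omega> \<partial>Q)"
proof -
  have s: "sets Q = sets P" and a: "absolutely_continuous P Q" using Q by (auto simp: ac_prob_def)
  have r: "rep (cls P X) \<in> borel_measurable P" using rep_L0(1)[OF cls_in_L0[OF X]] .
  have AEQ: "AE \<omega> in Q. rep (cls P X) \<omega> = X \<omega>"
    by (rule absolutely_continuous_AE[OF s a rep_cls[OF X]])
  have m: "rep (cls P X) \<in> borel_measurable Q" "X \<in> borel_measurable Q"
    using r X measurable_cong_sets[OF s refl] by auto
  show "cls P X \<in> L1 P Q \<longleftrightarrow> integrable Q X"
    unfolding L1_def using cls_in_L0[OF X] integrable_cong_AE[OF m AEQ] by simp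
  show "(\<integral>\<omega>. rep (cls P X) \<omega> \<partial>Q) = (\<integral>\<omega>. X \<omega> \<partial>Q)"
    by (rule integral_cong_AE[OF m AEQ])
qed

lemma s_E_alt:
  assumes M: "M \<noteq> {}" "M \<subseteq> M1 P K"
  shows "s_E P M K = {x \<in> E_space P M. \<exists>g\<in>K. L0_le P x g}"
proof -
  have KE: "K \<subseteq> E_space P M" using M by (auto simp: E_space_def M1_def)
  have EL: "E_space P M \<subseteq> L0 P" using M by (auto simp: E_space_def L1_def)
  have diff: "L0_diff P x y \<in> E_space P M" if x: "x \<in> E_space P M" and y: "y \<in> E_space P M" for x y
  proof -
    have [measurable]: "rep x \<in> borel_measurable P" "rep y \<in> borel_measurable P"
      using x y EL rep_L0(1) by blast+
    have "cls P (\<lambda>\<omega>. rep x \<omega> - rep y \<omega>) \<in> L1 P Q" if Q: "Q \<in> M" for Q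
    proof (subst L1_class(1))
      show "ac_prob P Q" using Q M by (auto simp: M1_def)
      show "integrable Q (\<lambda>\<omega>. rep x \<omega> - rep y \<omega>)"
        using x y Q by (auto simp: E_space_def L1_def)
    qed measurable
    then show ?thesis by (auto simp: E_space_def L0_diff_def)
  qed
  show ?thesis
  proof (intro equalityI subsetI)
    fix x assume "x \<in> s_E P M K"
    then obtain g h where gh: "g \<in> K" "h \<in> E_space P M" "L0_le P (L0_zero P) h" "x = L0_diff P g h"
      by (auto simp: s_E_def E_pos_def)
    have [measurable]: "rep g \<in> borel_measurable P" "rep h \<in> borel_measurable P"
      using gh KE EL rep_L0(1) by blast+
    have "g = cls P (rep g)" "h = cls P (rep h)" using gh KE EL rep_L0(2) by blast+
    then have "AE \<omega> in P. 0 \<le> rep h \<omega>"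
      using gh(3) L0_le_cls[of "\<lambda>_. 0" P "rep h"] by (simp add: L0_zero_def)
    then have "AE \<omega> in P. rep g \<omega> - rep h \<omega> \<le> rep g \<omega>" by auto
    then have "L0_le P x (cls P (rep g))"
      unfolding gh(4) L0_diff_def by (subst L0_le_cls) auto
    then show "x \<in> {x \<in> E_space P M. \<exists>g\<in>K. L0_le P x g}"
      using gh KE diff \<open>g = cls P (rep g)\<close> by auto
  next
    fix x assume "x \<in> {x \<in> E_space P M. \<exists>g\<in>K. L0_le P x g}"
    then obtain g where g: "x \<in> E_space P M" "g \<in> K" "L0_le P x g" by auto
    have [measurable]: "rep g \<in> borel_measurable P" "rep x \<in> borel_measurable P"
      using g KE EL rep_L0(1) by blast+
    have c: "g = cls P (rep g)" "x = cls P (rep x)" using g KE EL rep_L0(2) by blast+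
    define h where "h = L0_diff P g x"
    have "h \<in> E_space P M" unfolding h_def using diff g KE by blast
    moreover have "L0_le P (L0_zero P) h"
      unfolding h_def L0_diff_def L0_zero_def using g(3) by (subst L0_le_cls) (auto simp: L0_le_def)
    moreover have "L0_diff P g h = x"
    proof -
      have "L0_diff P (cls P (rep g)) (cls P (\<lambda>\<omega>. rep g \<omega> - rep x \<omega>)) = cls P (rep x)"
        by (subst L0_diff_cls) auto
      then show ?thesis using c unfolding h_def L0_diff_def by simp
    qed
    ultimately show "x \<in> s_E P M K"
      using g(2) unfolding s_E_def E_pos_def by blast
  qed
qed

end

(* All three conditions are bipolar calculus. Separating a point from a cone in finitely many
   coordinates gives the bipolar theorem for the weak topologies, so c_E(K) is the bipolar of s_E(K)
   and the closure of W(R(M)) is the polar of the polar of R(M). The link to M_1 is that the polar of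
   s_E(K) in F equals F \<inter> W(R(M_1)): testing w in this polar against - 1_{w < 0} in s_E(K) gives
   w \<ge> 0, so w is a multiple of the density of a probability measure, and testing against K puts
   this measure into M_1. *)

theory Submission
  imports Defs
begin

text \<open>A basic weak neighbourhood constrains only finitely many functionals, so separation in
  finite dimensions is enough for the bipolar theorem, and topologies that are not Hausdorff are
  covered as well. Two obstacles shape the rest. Elements of \<open>L0 P\<close> are classes whose
  operations are computed on representatives, so every algebraic identity has to be transported
  through almost-everywhere equalities. Moreover, the density of a measure in M_1 outside M may lie
  outside F, and its product with an element of E may fail to be integrable; only its products with
  elements of K are controlled. Intersecting W(R(M_1)) with F restores a meaningful pairing with all
  of E. Since c_E(K) is a bipolar and three polars reduce to one, the second equality in (iii)
  always holds, (i) and (iii) state the same equation, and (ii) is that equation after taking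
  polars.\<close>

section \<open>Separation from a convex cone in finitely many coordinates\<close>

text \<open>First-order condition at t = 0: the right-hand side is |a|^2 - 2 t <a,v> + t^2 |v|^2, so
  dividing by t and letting t tend to 0 from above leaves the sign of <a,v>.\<close>

lemma inner_nonpos_if_sum_squares_le:
  fixes a v :: "'i \<Rightarrow> real"
  assumes "\<And>t. 0 < t \<Longrightarrow> t < 1 \<Longrightarrow> (\<Sum>i\<in>I. (a i)\<^sup>2) \<le> (\<Sum>i\<in>I. (a i - t * v i)\<^sup>2)"
  shows "(\<Sum>i\<in>I. a i * v i) \<le> 0"
proof -
  define A V where "A = (\<Sum>i\<in>I. a i * v i)" and "V = (\<Sum>i\<in>I. (v i)\<^sup>2)"
  have le: "2 * A \<le> t * V" if t: "0 < t" "t < 1" for t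
  proof -
    have "(\<Sum>i\<in>I. (a i - t * v i)\<^sup>2) = (\<Sum>i\<in>I. (a i)\<^sup>2 - 2 * t * (a i * v i) + t * t * (v i)\<^sup>2)"
      by (rule sum.cong) (auto simp: power2_eq_square algebra_simps)
    also have "\<dots> = (\<Sum>i\<in>I. (a i)\<^sup>2) - 2 * t * A + t * t * V"
      by (simp add: sum.distrib sum_subtractf sum_distrib_left A_def V_def)
    finally have "t * (2 * A) \<le> t * (t * V)"
      using assms[OF t] by (simp add: algebra_simps)
    with t show ?thesis by simp
  qed
  have "((\<lambda>t. t * V) \<longlongrightarrow> 0 * V) (at_right 0)"
    by (intro tendsto_intros)
  moreover have "\<forall>\<^sub>F t in at_right (0::real). 2 * A \<le> t * V"
    using le eventually_at_right_less[of "0::real"]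
    by (auto simp: eventually_at_right_field intro!: exI[of _ 1])
  ultimately have "2 * A \<le> 0 * V"
    by (intro tendsto_lowerbound[where F="at_right (0::real)"]) auto
  then show ?thesis by (simp add: A_def)
qed

text \<open>The separating vector is \<open>x - p\<close>, where \<open>p\<close> is the projection of \<open>x\<close> onto the closure of
  the cone; minimizing sequences converge by the parallelogram identity.\<close>

lemma finite_cone_separation:
  fixes D :: "('i \<Rightarrow> real) set" and x :: "'i \<Rightarrow> real"
  assumes I: "finite I" and ne: "D \<noteq> {}"
    and add: "\<And>u v. u \<in> D \<Longrightarrow> v \<in> D \<Longrightarrow> (\<lambda>i. u i + v i) \<in> D"
    and scale: "\<And>c v. 0 \<le> c \<Longrightarrow> v \<in> D \<Longrightarrow> (\<lambda>i. c * v i) \<in> D"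
    and \<epsilon>: "0 < \<epsilon>" and far: "\<And>v. v \<in> D \<Longrightarrow> \<exists>i\<in>I. \<epsilon> \<le> \<bar>v i - x i\<bar>"
  shows "\<exists>a. (\<forall>v\<in>D. (\<Sum>i\<in>I. a i * v i) \<le> 0) \<and> 0 < (\<Sum>i\<in>I. a i * x i)"
proof -
  \<comment> \<open>\<open>q\<close> is the squared Euclidean distance to \<open>x\<close> in the
    coordinates from \<open>I\<close>, and \<open>d\<close> its infimum over the cone;
    \<open>far\<close> keeps \<open>d\<close> away from 0.\<close>
  define q where "q v = (\<Sum>i\<in>I. (x i - v i)\<^sup>2)" for v
  define d where "d = Inf (q ` D)"
  have q_ge: "\<epsilon>\<^sup>2 \<le> q v" if v: "v \<in> D" for v
  proof -
    obtain i where i: "i \<in> I" "\<epsilon> \<le> \<bar>v i - x i\<bar>" using far[OF v] by auto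
    have "\<epsilon>\<^sup>2 \<le> (\<bar>v i - x i\<bar>)\<^sup>2" using i(2) \<epsilon> by (intro power_mono) auto
    also have "\<dots> = (x i - v i)\<^sup>2" by (simp add: power2_commute)
    also have "\<dots> \<le> q v" unfolding q_def using i(1) I by (intro member_le_sum) auto
    finally show ?thesis .
  qed
  have bdd: "bdd_below (q ` D)" using q_ge by (intro bdd_belowI2) auto
  have d_le: "d \<le> q v" if "v \<in> D" for v
    unfolding d_def using bdd that by (intro cInf_lower) auto
  have "\<epsilon>\<^sup>2 \<le> d" unfolding d_def using ne q_ge by (intro cInf_greatest) auto
  then have d_pos: "0 < d" using \<epsilon> by (smt (verit) zero_less_power)
  have "\<exists>v\<in>D. q v < d + 1 / real (Suc n)" for n
  proof -
    have "Inf (q ` D) < d + 1 / real (Suc n)" by (simp add: d_def)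
    then show ?thesis using ne bdd by (subst (asm) cInf_less_iff) auto
  qed
  then obtain c where c: "\<And>n. c n \<in> D" and q_less: "\<And>n. q (c n) < d + 1 / real (Suc n)"
    by metis
  have close: "(c m i - c n i)\<^sup>2 \<le> 2 / real (Suc m) + 2 / real (Suc n)" if i: "i \<in> I" for m n i
  proof -
    \<comment> \<open>The midpoint lies in the cone, so its \<open>q\<close> is at least
      \<open>d\<close>. In the parallelogram identity the multiples of \<open>d\<close> then cancel,
      and only the errors of the minimizing sequence remain.\<close>
    have mid: "(\<lambda>j. (1/2) * (c m j + c n j)) \<in> D" by (intro scale add c) simp
    have "(\<Sum>j\<in>I. (c m j - c n j)\<^sup>2) + 4 * q (\<lambda>j. (1/2) * (c m j + c n j)) = 2 * q (c m) + 2 * q (c n)"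
      unfolding q_def sum_distrib_left sum.distrib[symmetric]
      by (rule sum.cong) (auto simp: power2_eq_square field_simps)
    moreover have "(c m i - c n i)\<^sup>2 \<le> (\<Sum>j\<in>I. (c m j - c n j)\<^sup>2)"
      using i I by (intro member_le_sum[where f="\<lambda>j. (c m j - c n j)\<^sup>2"]) auto
    ultimately show ?thesis
      using d_le[OF mid] q_less[of m] q_less[of n] by simp
  qed
  have "convergent (\<lambda>n. c n i)" if i: "i \<in> I" for i
  proof -
    have "Cauchy (\<lambda>n. c n i)"
    proof (rule metric_CauchyI)
      fix e :: real assume e: "0 < e"
      \<comment> \<open>Each of the two error terms is at most 2/(N+1), so their sum is at most
        4/(N+1), which explains the factor 4.\<close>
      then obtain N where N: "inverse (real (Suc N)) < e\<^sup>2 / 4"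
        using reals_Archimedean[of "e\<^sup>2 / 4"] by auto
      have "dist (c m i) (c n i) < e" if mn: "N \<le> m" "N \<le> n" for m n
      proof -
        have "1 / real (Suc m) \<le> 1 / real (Suc N)" "1 / real (Suc n) \<le> 1 / real (Suc N)"
          using mn by (auto intro!: divide_left_mono)
        then have "(c m i - c n i)\<^sup>2 < e\<^sup>2"
          using close[OF i, of m n] N by (simp add: inverse_eq_divide)
        then have "\<bar>c m i - c n i\<bar> < e" using e by (metis abs_le_square_iff abs_of_pos not_le)
        then show ?thesis by (simp add: dist_real_def)
      qed
      then show "\<exists>N. \<forall>m\<ge>N. \<forall>n\<ge>N. dist (c m i) (c n i) < e" by blast
    qed
    then show ?thesis by (simp add: Cauchy_convergent_iff)
  qed
  then obtain p where p: "\<And>i. i \<in> I \<Longrightarrow> (\<lambda>n. c n i) \<longlonglongrightarrow> p i"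
    unfolding convergent_def by metis
  define a where "a i = x i - p i" for i
  have lim: "(\<lambda>n. q (c n)) \<longlonglongrightarrow> (\<Sum>i\<in>I. (x i - p i)\<^sup>2)"
    unfolding q_def by (intro tendsto_intros p)
  moreover have "(\<lambda>n. d + 1 / real (Suc n)) \<longlonglongrightarrow> d + 0"
    by (intro tendsto_add tendsto_const LIMSEQ_Suc[OF lim_1_over_n])
  ultimately have "(\<Sum>i\<in>I. (x i - p i)\<^sup>2) \<le> d + 0"
    using less_imp_le[OF q_less] by (intro LIMSEQ_le[where Y="\<lambda>n. d + 1 / real (Suc n)"]) blast+
  then have a_le: "(\<Sum>i\<in>I. (a i)\<^sup>2) \<le> d" by (simp add: a_def)
  have a_pos: "0 < (\<Sum>i\<in>I. (a i)\<^sup>2)"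
    unfolding a_def using d_pos LIMSEQ_le_const[OF lim, of d] d_le[OF c] by auto
  \<comment> \<open>The limit \<open>p\<close> need not lie in \<open>D\<close>. Minimality is
    therefore used at the points c n + t v of the cone and passed to the limit.\<close>
  have polar: "(\<Sum>i\<in>I. a i * v i) \<le> 0" if v: "v \<in> D" for v
  proof (rule inner_nonpos_if_sum_squares_le)
    fix t :: real assume t: "0 < t" "t < 1"
    have "(\<lambda>n. q (\<lambda>i. c n i + t * v i)) \<longlonglongrightarrow> (\<Sum>i\<in>I. (x i - (p i + t * v i))\<^sup>2)"
      unfolding q_def by (intro tendsto_intros p)
    moreover have "d \<le> q (\<lambda>i. c n i + t * v i)" for n
      using t v by (intro d_le add scale c) auto
    ultimately have "d \<le> (\<Sum>i\<in>I. (x i - (p i + t * v i))\<^sup>2)"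
      by (intro LIMSEQ_le_const) auto
    then show "(\<Sum>i\<in>I. (a i)\<^sup>2) \<le> (\<Sum>i\<in>I. (a i - t * v i)\<^sup>2)"
      using a_le by (simp add: a_def algebra_simps)
  qed
  \<comment> \<open>Shrinking by the factor 1 - t stays in the cone and moves \<open>p\<close> in
    direction -p. Hence <a,p> is nonnegative, and <a,x> = |a|^2 + <a,p> is positive.\<close>
  have "(\<Sum>i\<in>I. a i * (- p i)) \<le> 0"
  proof (rule inner_nonpos_if_sum_squares_le)
    fix t :: real assume t: "0 < t" "t < 1"
    have "(\<lambda>n. q (\<lambda>i. (1 - t) * c n i)) \<longlonglongrightarrow> (\<Sum>i\<in>I. (x i - (1 - t) * p i)\<^sup>2)"
      unfolding q_def by (intro tendsto_intros p)
    moreover have "d \<le> q (\<lambda>i. (1 - t) * c n i)" for n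
      using t by (intro d_le scale c) auto
    ultimately have "d \<le> (\<Sum>i\<in>I. (x i - (1 - t) * p i)\<^sup>2)"
      by (intro LIMSEQ_le_const) auto
    then show "(\<Sum>i\<in>I. (a i)\<^sup>2) \<le> (\<Sum>i\<in>I. (a i - t * (- p i))\<^sup>2)"
      using a_le by (simp add: a_def algebra_simps)
  qed
  moreover have "(\<Sum>i\<in>I. a i * x i) = (\<Sum>i\<in>I. (a i)\<^sup>2) - (\<Sum>i\<in>I. a i * (- p i))"
    unfolding sum_subtractf[symmetric]
    by (rule sum.cong) (auto simp: a_def power2_eq_square algebra_simps)
  ultimately have "0 < (\<Sum>i\<in>I. a i * x i)" using a_pos by linarith
  with polar show ?thesis by blast
qed

section \<open>Weak topologies and the bipolar theorem\<close>

text \<open>Induction over the generation of open sets: an intersection takes the union of both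
  finite sets and the smaller radius, a union takes the data of one member, and a subbasic set needs
  a single functional.\<close>

lemma weak_topology_nbhd:
  assumes "openin (weak_topology X Y b) U" and "x \<in> U"
  shows "\<exists>J \<epsilon>. finite J \<and> J \<subseteq> Y \<and> 0 < \<epsilon> \<and> {z \<in> X. \<forall>y\<in>J. \<bar>b z y - b x y\<bar> < \<epsilon>} \<subseteq> U"
proof -
  have "generate_topology_on {{x \<in> X. b x y \<in> U} | y U. y \<in> Y \<and> open U} U"
    using assms(1) by (simp add: weak_topology_def openin_topology_generated_by)
  then show ?thesis using assms(2)
  proof induction
    case Empty
    then show ?case by simp
  next
    case (Int A B)
    from Int.IH(1) Int.prems obtain J \<epsilon> where "finite J" "J \<subseteq> Y" "0 < \<epsilon>"
      "{z \<in> X. \<forall>y\<in>J. \<bar>b z y - b x y\<bar> < \<epsilon>} \<subseteq> A" by auto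
    moreover from Int.IH(2) Int.prems obtain J' \<epsilon>' where
      "finite J'" "J' \<subseteq> Y" "0 < \<epsilon>'" "{z \<in> X. \<forall>y\<in>J'. \<bar>b z y - b x y\<bar> < \<epsilon>'} \<subseteq> B" by auto
    ultimately show ?case
      by (intro exI[of _ "J \<union> J'"] exI[of _ "min \<epsilon> \<epsilon>'"]) auto
  next
    case (UN \<A>)
    then obtain A where "A \<in> \<A>" "x \<in> A" by auto
    from UN.IH[OF this] obtain J \<epsilon> where
      "finite J" "J \<subseteq> Y" "0 < \<epsilon>" "{z \<in> X. \<forall>y\<in>J. \<bar>b z y - b x y\<bar> < \<epsilon>} \<subseteq> A" by auto
    with \<open>A \<in> \<A>\<close> show ?case by (intro exI[of _ J] exI[of _ \<epsilon>]) auto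
  next
    case (Basis A)
    then obtain y V where A: "A = {x \<in> X. b x y \<in> V}" "y \<in> Y" "open V" by auto
    then obtain \<epsilon> where "0 < \<epsilon>" "ball (b x y) \<epsilon> \<subseteq> V"
      using Basis.prems by (auto simp: open_contains_ball)
    with A show ?case
      by (intro exI[of _ "{y}"] exI[of _ \<epsilon>]) (auto simp: dist_real_def abs_minus_commute subset_iff)
  qed
qed

text \<open>The linear structure is only used through the pairing, so \<open>X\<close> and \<open>Y\<close> may be arbitrary sets.\<close>

lemma weak_bipolar:
  fixes b :: "'x \<Rightarrow> 'y \<Rightarrow> real"
  assumes CX: "C \<subseteq> X" and ne: "C \<noteq> {}"
    and C_add: "\<And>u v. u \<in> C \<Longrightarrow> v \<in> C \<Longrightarrow> \<exists>w\<in>C. \<forall>y\<in>Y. b w y = b u y + b v y"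
    and C_scale: "\<And>c v. 0 \<le> c \<Longrightarrow> v \<in> C \<Longrightarrow> \<exists>w\<in>C. \<forall>y\<in>Y. b w y = c * b v y"
    and Y_zero: "\<exists>w\<in>Y. \<forall>x\<in>X. b x w = 0"
    and Y_add: "\<And>u v. u \<in> Y \<Longrightarrow> v \<in> Y \<Longrightarrow> \<exists>w\<in>Y. \<forall>x\<in>X. b x w = b x u + b x v"
    and Y_scale: "\<And>c v. v \<in> Y \<Longrightarrow> \<exists>w\<in>Y. \<forall>x\<in>X. b x w = c * b x v"
  shows "weak_topology X Y b closure_of C
    = {x \<in> X. \<forall>y\<in>Y. (\<forall>c\<in>C. b c y \<le> 0) \<longrightarrow> b x y \<le> 0}"
proof (intro equalityI subsetI)
  have top: "topspace (weak_topology X Y b) = X"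
    using Y_zero by (intro topspace_weak_topology) auto
  {
    fix x assume x: "x \<in> weak_topology X Y b closure_of C"
    then have "x \<in> X" using top closure_of_subset_topspace by fastforce
    moreover have "b x y \<le> 0" if y: "y \<in> Y" "\<forall>c\<in>C. b c y \<le> 0" for y
    proof (rule ccontr)
      assume "\<not> b x y \<le> 0"
      \<comment> \<open>The open half-space where \<open>b\<close> is positive at \<open>y\<close>
        contains \<open>x\<close>, so it would have to meet \<open>C\<close>.\<close>
      then have mem: "x \<in> {x \<in> X. b x y \<in> {0<..}}" using \<open>x \<in> X\<close> by simp
      have opn: "openin (weak_topology X Y b) {x \<in> X. b x y \<in> {0<..}}"
        unfolding weak_topology_def
        by (intro topology_generated_by_Basis CollectI exI conjI) (use y(1) in auto)
      have "\<exists>c. c \<in> C \<and> c \<in> T"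
        if "x \<in> T" "openin (weak_topology X Y b) T" for T
        using x that by (simp add: in_closure_of)
      from this[OF mem opn]
      obtain c where "c \<in> C" "0 < b c y" by auto
      with y(2) show False using not_less by blast
    qed
    ultimately show "x \<in> {x \<in> X. \<forall>y\<in>Y. (\<forall>c\<in>C. b c y \<le> 0) \<longrightarrow> b x y \<le> 0}" by blast
  next
    fix x assume x: "x \<in> {x \<in> X. \<forall>y\<in>Y. (\<forall>c\<in>C. b c y \<le> 0) \<longrightarrow> b x y \<le> 0}"
    show "x \<in> weak_topology X Y b closure_of C"
    proof (rule ccontr)
      assume "x \<notin> weak_topology X Y b closure_of C"
      then obtain U where U: "openin (weak_topology X Y b) U" "x \<in> U" "C \<inter> U = {}"
        using x top by (auto simp: in_closure_of)
      from weak_topology_nbhd[OF U(1,2)] obtain J \<epsilon> where J: "finite J" "J \<subseteq> Y" "0 < \<epsilon>"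
        "{z \<in> X. \<forall>y\<in>J. \<bar>b z y - b x y\<bar> < \<epsilon>} \<subseteq> U" by auto
      \<comment> \<open>Coordinates outside \<open>J\<close> are set to 0: closure of
        \<open>D\<close> under sums is an equality of functions on the whole type, while the
        identities for \<open>b\<close> hold on \<open>Y\<close> only.\<close>
      define D where "D = (\<lambda>c y. if y \<in> J then b c y else 0) ` C"
      have "\<exists>a. (\<forall>v\<in>D. (\<Sum>i\<in>J. a i * v i) \<le> 0) \<and> 0 < (\<Sum>i\<in>J. a i * b x i)"
      proof (rule finite_cone_separation)
        fix u v assume "u \<in> D" "v \<in> D"
        then obtain c c' where c: "c \<in> C" "c' \<in> C" "u = (\<lambda>y. if y \<in> J then b c y else 0)"
          "v = (\<lambda>y. if y \<in> J then b c' y else 0)" by (auto simp: D_def)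
        from C_add[OF c(1,2)] obtain w where "w \<in> C" "\<forall>y\<in>Y. b w y = b c y + b c' y" by auto
        then show "(\<lambda>i. u i + v i) \<in> D"
          using J(2) by (auto simp: D_def c fun_eq_iff subset_iff intro!: image_eqI[of _ _ w])
      next
        fix r v assume r: "0 \<le> (r::real)" and "v \<in> D"
        then obtain c where c: "c \<in> C" "v = (\<lambda>y. if y \<in> J then b c y else 0)"
          by (auto simp: D_def)
        from C_scale[OF r c(1)] obtain w where "w \<in> C" "\<forall>y\<in>Y. b w y = r * b c y" by auto
        then show "(\<lambda>i. r * v i) \<in> D"
          using J(2) by (auto simp: D_def c fun_eq_iff subset_iff intro!: image_eqI[of _ _ w])
      next
        fix v assume "v \<in> D"
        then obtain c where c: "c \<in> C" "v = (\<lambda>y. if y \<in> J then b c y else 0)"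
          by (auto simp: D_def)
        then have "c \<notin> U" "c \<in> X" using U(3) CX by auto
        then have "c \<notin> {z \<in> X. \<forall>y\<in>J. \<bar>b z y - b x y\<bar> < \<epsilon>}" using J(4) by blast
        then obtain i where "i \<in> J" "\<epsilon> \<le> \<bar>b c i - b x i\<bar>"
          using \<open>c \<in> X\<close> by (auto simp: not_less)
        then show "\<exists>i\<in>J. \<epsilon> \<le> \<bar>v i - b x i\<bar>" using c(2) by auto
      qed (use J ne in \<open>auto simp: D_def\<close>)
      then obtain a where a: "\<forall>v\<in>D. (\<Sum>i\<in>J. a i * v i) \<le> 0" "0 < (\<Sum>i\<in>J. a i * b x i)" by blast
      \<comment> \<open>The separating coefficients are realized by a single element of
        \<open>Y\<close>, which contradicts the polar condition on \<open>x\<close>.\<close>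
      have "\<exists>w\<in>Y. \<forall>x\<in>X. b x w = (\<Sum>i\<in>J. a i * b x i)" using J(1,2)
      proof (induction J rule: finite_induct)
        case empty
        then show ?case using Y_zero by simp
      next
        case (insert y J)
        then obtain w where w: "w \<in> Y" "\<forall>x\<in>X. b x w = (\<Sum>i\<in>J. a i * b x i)" by auto
        from Y_scale[of y "a y"] insert.prems obtain v where
          v: "v \<in> Y" "\<forall>x\<in>X. b x v = a y * b x y" by auto
        from Y_add[OF v(1) w(1)] v(2) w(2) insert.hyps show ?case by simp
      qed
      then obtain w where w: "w \<in> Y" "\<And>x. x \<in> X \<Longrightarrow> b x w = (\<Sum>i\<in>J. a i * b x i)" by auto
      have "b c w \<le> 0" if "c \<in> C" for c
        using a(1) that CX by (auto simp: D_def w(2) subset_iff cong: sum.cong)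
      with x w(1) have "b x w \<le> 0" by auto
      with a(2) w(2) x show False by auto
    qed
  }
qed

section \<open>Algebra of classes, wedges and linear spans\<close>

lemma L0_eqI:
  assumes "x \<in> L0 P" "y \<in> L0 P" "AE \<omega> in P. rep x \<omega> = rep y \<omega>"
  shows "x = y"
  using assms rep_L0 cls_eq_iff by metis

lemma L0_add_in_L0 [simp]: "x \<in> L0 P \<Longrightarrow> y \<in> L0 P \<Longrightarrow> L0_add P x y \<in> L0 P"
  unfolding L0_add_def by (intro cls_in_L0 borel_measurable_add rep_L0)

lemma L0_scale_in_L0 [simp]: "x \<in> L0 P \<Longrightarrow> L0_scale P c x \<in> L0 P"
  unfolding L0_scale_def by (intro cls_in_L0 borel_measurable_times borel_measurable_const rep_L0)

lemma L0_zero_in_L0 [simp]: "L0_zero P \<in> L0 P"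
  unfolding L0_zero_def by (intro cls_in_L0) simp

lemma AE_rep_add:
  assumes "x \<in> L0 P" "y \<in> L0 P"
  shows "AE \<omega> in P. rep (L0_add P x y) \<omega> = rep x \<omega> + rep y \<omega>"
  unfolding L0_add_def using assms rep_L0(1)[of _ P] by (intro rep_cls) auto

lemma AE_rep_scale:
  assumes "x \<in> L0 P"
  shows "AE \<omega> in P. rep (L0_scale P c x) \<omega> = c * rep x \<omega>"
  unfolding L0_scale_def using assms rep_L0(1)[of _ P] by (intro rep_cls) auto

lemma AE_rep_zero: "AE \<omega> in P. rep (L0_zero P) \<omega> = 0"
  unfolding L0_zero_def by (intro rep_cls) auto

lemma L0_scale_0: "x \<in> L0 P \<Longrightarrow> L0_scale P 0 x = L0_zero P"
  by (simp add: L0_scale_def L0_zero_def)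

lemma lin_subspace_imp_wedge: "lin_subspace P V \<Longrightarrow> wedge P V"
  by (auto simp: lin_subspace_def wedge_def)

lemma lin_subspace_L0: "lin_subspace P (L0 P)"
  by (simp add: lin_subspace_def)

lemma wedge_zero: "wedge P C \<Longrightarrow> L0_zero P \<in> C"
  using L0_scale_0[of _ P] unfolding wedge_def by (metis all_not_in_conv order_refl subsetD)

lemma wedgeI:
  assumes "C \<subseteq> L0 P" "C \<noteq> {}"
    and "\<And>x y. x \<in> C \<Longrightarrow> y \<in> C \<Longrightarrow> L0_add P x y \<in> C"
    and "\<And>c x. 0 \<le> c \<Longrightarrow> x \<in> C \<Longrightarrow> L0_scale P c x \<in> C"
  shows "wedge P C"
  using assms by (auto simp: wedge_def)

text \<open>A wedge is given by convexity and nonnegative scaling, so a sum is obtained as twice the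
  midpoint.\<close>

lemma wedge_add:
  assumes C: "wedge P C" and x: "x \<in> C" and y: "y \<in> C"
  shows "L0_add P x y \<in> C"
proof -
  let ?z = "L0_add P (L0_scale P (1/2) x) (L0_scale P (1 - 1/2) y)"
  have L: "x \<in> L0 P" "y \<in> L0 P" using assms by (auto simp: wedge_def)
  have convex: "L0_add P (L0_scale P t x) (L0_scale P (1 - t) y) \<in> C" if "0 \<le> t" "t \<le> 1" for t
    using assms that by (simp add: wedge_def)
  have "?z \<in> C" by (rule convex) auto
  then have "L0_scale P 2 ?z \<in> C" using C by (auto simp: wedge_def)
  moreover have "L0_scale P 2 ?z = L0_add P x y"
  proof (rule L0_eqI)
    show "AE \<omega> in P. rep (L0_scale P 2 ?z) \<omega> = rep (L0_add P x y) \<omega>"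
      using AE_rep_scale[of ?z P 2] AE_rep_add[of "L0_scale P (1/2) x" P "L0_scale P (1 - 1/2) y"]
        AE_rep_scale[OF L(1), of "1/2"] AE_rep_scale[OF L(2), of "1 - 1/2"] AE_rep_add[OF L] L
      by auto
  qed (use L in auto)
  ultimately show ?thesis by simp
qed

lemma wedge_hull_superset: "S \<subseteq> wedge_hull P S"
  by (auto simp: wedge_hull_def)

lemma wedge_hull_minimal: "wedge P C \<Longrightarrow> S \<subseteq> C \<Longrightarrow> wedge_hull P S \<subseteq> C"
  by (auto simp: wedge_hull_def)

lemma wedge_wedge_hull:
  assumes "S \<noteq> {}" "S \<subseteq> L0 P"
  shows "wedge P (wedge_hull P S)"
proof -
  have "wedge_hull P S \<subseteq> L0 P"
    using wedge_hull_minimal[OF lin_subspace_imp_wedge[OF lin_subspace_L0]] assms(2) .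
  moreover have "wedge_hull P S \<noteq> {}" using wedge_hull_superset assms(1) by blast
  ultimately show ?thesis by (auto simp: wedge_def wedge_hull_def)
qed

lemma lin_span_superset: "S \<subseteq> lin_span P S"
  by (auto simp: lin_span_def)

lemma lin_span_minimal: "lin_subspace P V \<Longrightarrow> S \<subseteq> V \<Longrightarrow> lin_span P S \<subseteq> V"
  by (auto simp: lin_span_def)

lemma lin_subspace_lin_span:
  assumes "S \<subseteq> L0 P"
  shows "lin_subspace P (lin_span P S)"
proof -
  have "lin_span P S \<subseteq> L0 P"
    using lin_span_minimal[OF lin_subspace_L0] assms .
  then show ?thesis by (auto simp: lin_subspace_def lin_span_def)
qed

section \<open>Densities and the pairing\<close>

lemma RN_class_in_L0: "RN_class P Q \<in> L0 P"
  unfolding RN_class_def by (rule cls_in_L0) measurable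

lemma AE_rep_RN_class: "AE \<omega> in P. rep (RN_class P Q) \<omega> = enn2real (RN_deriv P Q \<omega>)"
  unfolding RN_class_def by (rule rep_cls) measurable

text \<open>Change of measure: integrability and expectation under \<open>Q\<close> become
  statements about products under \<open>P\<close>, so that membership in E and polarity can both be
  read off the pairing.\<close>

lemma rep_RN_class_integral:
  assumes P: "prob_space P" and Q: "ac_prob P Q" and z: "z \<in> L0 P"
  shows "integrable P (\<lambda>\<omega>. rep z \<omega> * rep (RN_class P Q) \<omega>) \<longleftrightarrow> integrable Q (rep z)"
    and "pairing P z (RN_class P Q) = (\<integral>\<omega>. rep z \<omega> \<partial>Q)"
proof -
  interpret prob_space P by fact
  have Q': "sigma_finite_measure Q" "absolutely_continuous P Q" "sets Q = sets P"
    using Q by (auto simp: ac_prob_def prob_space_imp_sigma_finite)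
  note [measurable] = rep_L0(1)[OF z] rep_L0(1)[OF RN_class_in_L0]
  have eq: "AE \<omega> in P. rep z \<omega> * rep (RN_class P Q) \<omega> = enn2real (RN_deriv P Q \<omega>) * rep z \<omega>"
    using AE_rep_RN_class[of P Q] by auto
  show "integrable P (\<lambda>\<omega>. rep z \<omega> * rep (RN_class P Q) \<omega>) \<longleftrightarrow> integrable Q (rep z)"
    unfolding RN_deriv_integrable[OF Q' rep_L0(1)[OF z]]
    by (rule integrable_cong_AE[OF _ _ eq]) measurable
  show "pairing P z (RN_class P Q) = (\<integral>\<omega>. rep z \<omega> \<partial>Q)"
    unfolding RN_deriv_integral[OF Q' rep_L0(1)[OF z]] pairing_def
    by (rule integral_cong_AE[OF _ _ eq]) measurable
qed

text \<open>The converse passage, from a normalized nonnegative class to a measure; that its density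
  is the given class is the almost-everywhere uniqueness of Radon-Nikodym derivatives.\<close>

lemma RN_class_density:
  assumes P: "prob_space P" and w: "w \<in> L0 P" "AE \<omega> in P. 0 \<le> rep w \<omega>"
    and int: "(\<integral>\<omega>. rep w \<omega> \<partial>P) = 1"
  shows "ac_prob P (density P (rep w))" and "RN_class P (density P (rep w)) = w"
proof -
  interpret prob_space P by fact
  note [measurable] = rep_L0(1)[OF w(1)]
  \<comment> \<open>The integral of a non-integrable function is 0 by convention, so the value 1
    already forces integrability.\<close>
  have "integrable P (rep w)" using int not_integrable_integral_eq by fastforce
  then have "(\<integral>\<^sup>+\<omega>. rep w \<omega> \<partial>P) = ennreal 1"
    using w(2) int by (simp add: nn_integral_eq_integral)
  then have "prob_space (density P (rep w))"
    by (intro prob_spaceI) (simp add: emeasure_density cong: nn_integral_cong)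
  then show "ac_prob P (density P (rep w))"
    by (auto simp: ac_prob_def intro!: absolutely_continuousI_density)
  have "AE \<omega> in P. ennreal (rep w \<omega>) = RN_deriv P (density P (rep w)) \<omega>"
    by (rule RN_deriv_unique) auto
  then have "AE \<omega> in P. rep (RN_class P (density P (rep w))) \<omega> = rep w \<omega>"
    using w(2) AE_rep_RN_class[of P "density P (rep w)"]
    by eventually_elim (metis enn2real_ennreal)
  then show "RN_class P (density P (rep w)) = w"
    using w(1) RN_class_in_L0 by (intro L0_eqI)
qed

lemma pairing_commute: "pairing P z w = pairing P w z"
  by (simp add: pairing_def mult.commute)

lemma pairing_zero_left: "pairing P (L0_zero P) w = 0"
  unfolding pairing_def using AE_rep_zero[of P] by (intro integral_eq_zero_AE) auto

text \<open>The integral defaults to 0 without integrability, so additivity of the pairing needs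
  integrability of both products, and this property has to be propagated alongside it.\<close>

lemma
  assumes x: "x \<in> L0 P" and y: "y \<in> L0 P" and w: "w \<in> L0 P"
    and ix: "integrable P (\<lambda>\<omega>. rep x \<omega> * rep w \<omega>)"
    and iy: "integrable P (\<lambda>\<omega>. rep y \<omega> * rep w \<omega>)"
  shows integrable_add_left: "integrable P (\<lambda>\<omega>. rep (L0_add P x y) \<omega> * rep w \<omega>)"
    and pairing_add_left: "pairing P (L0_add P x y) w = pairing P x w + pairing P y w"
proof -
  note [measurable] = rep_L0(1)[OF x] rep_L0(1)[OF y] rep_L0(1)[OF w]
    rep_L0(1)[OF L0_add_in_L0[OF x y]]
  have eq: "AE \<omega> in P. rep x \<omega> * rep w \<omega> + rep y \<omega> * rep w \<omega> = rep (L0_add P x y) \<omega> * rep w \<omega>"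
    using AE_rep_add[OF x y] by (auto simp: distrib_right)
  show "integrable P (\<lambda>\<omega>. rep (L0_add P x y) \<omega> * rep w \<omega>)"
    by (rule integrable_cong_AE_imp[OF Bochner_Integration.integrable_add[OF ix iy]])
      (use eq in auto)
  show "pairing P (L0_add P x y) w = pairing P x w + pairing P y w"
    unfolding pairing_def Bochner_Integration.integral_add[OF ix iy, symmetric]
    by (rule integral_cong_AE) (use eq in auto)
qed

lemma
  assumes x: "x \<in> L0 P" and w: "w \<in> L0 P"
    and ix: "integrable P (\<lambda>\<omega>. rep x \<omega> * rep w \<omega>)"
  shows integrable_scale_left: "integrable P (\<lambda>\<omega>. rep (L0_scale P c x) \<omega> * rep w \<omega>)"
    and pairing_scale_left: "pairing P (L0_scale P c x) w = c * pairing P x w"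
proof -
  note [measurable] = rep_L0(1)[OF x] rep_L0(1)[OF w] rep_L0(1)[OF L0_scale_in_L0[OF x]]
  have eq: "AE \<omega> in P. c * (rep x \<omega> * rep w \<omega>) = rep (L0_scale P c x) \<omega> * rep w \<omega>"
    using AE_rep_scale[OF x, of c] by auto
  show "integrable P (\<lambda>\<omega>. rep (L0_scale P c x) \<omega> * rep w \<omega>)"
    by (rule integrable_cong_AE_imp[OF integrable_mult_right[OF ix, of c]]) (use eq in auto)
  show "pairing P (L0_scale P c x) w = c * pairing P x w"
    unfolding pairing_def integral_mult_right_zero[symmetric]
    by (rule integral_cong_AE) (use eq in auto)
qed

section \<open>The dual pair (E, F)\<close>

locale wedge_duality = prob_space P for P :: "'a measure" +
  fixes K :: "('a \<Rightarrow> real) set set" and M :: "'a measure set"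
  assumes wedge_K: "wedge P K" and M_ne: "M \<noteq> {}" and M_sub: "M \<subseteq> M1 P K"
begin

abbreviation "E \<equiv> E_space P M"
abbreviation "F \<equiv> F_space P M"

lemma ac_M: "Q \<in> M \<Longrightarrow> ac_prob P Q"
  using M_sub by (auto simp: M1_def)

text \<open>Stated under \<open>P\<close> alone, membership fits the lemmas on integrability of sums
  and multiples. Nonemptiness of \<open>M\<close> puts \<open>z\<close> into \<open>L0 P\<close>,
  since an empty intersection would contain everything.\<close>

lemma E_iff: "z \<in> E \<longleftrightarrow> z \<in> L0 P \<and> (\<forall>Q\<in>M. integrable P (\<lambda>\<omega>. rep z \<omega> * rep (RN_class P Q) \<omega>))"
  using M_ne rep_RN_class_integral(1)[OF prob_space_axioms ac_M]
  by (auto simp: E_space_def L1_def)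

lemma E_L0: "z \<in> E \<Longrightarrow> z \<in> L0 P"
  by (simp add: E_iff)

lemma subspace_E: "lin_subspace P E"
  unfolding lin_subspace_def
proof (intro conjI ballI allI)
  have "integrable Q (rep (L0_zero P))" if "Q \<in> M" for Q
    using L1_class(1)[OF ac_M[OF that], of "\<lambda>_. 0"] by (simp add: L0_zero_def L1_def)
  then show "L0_zero P \<in> E" by (auto simp: E_space_def L1_def)
qed (auto simp: E_iff RN_class_in_L0 intro!: integrable_add_left integrable_scale_left)

lemma K_E: "K \<subseteq> E"
  using M_sub by (auto simp: E_space_def M1_def)

text \<open>Each measure in \<open>M\<close> is finite, so bounded classes are always available as
  test elements: below, the negative indicator that detects positivity and the constant 1 that
  measures total mass.\<close>

lemma bounded_in_E:
  assumes X: "X \<in> borel_measurable P" and B: "\<And>\<omega>. \<bar>X \<omega>\<bar> \<le> B"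
  shows "cls P X \<in> E"
proof -
  have "cls P X \<in> L1 P Q" if Q: "Q \<in> M" for Q
  proof (subst L1_class(1)[OF ac_M[OF Q] X])
    interpret Q: prob_space Q using ac_M[OF Q] by (simp add: ac_prob_def)
    have "X \<in> borel_measurable Q"
      using X ac_M[OF Q] measurable_cong_sets[of Q P] by (auto simp: ac_prob_def)
    then show "integrable Q X"
      using B by (intro Q.integrable_const_bound[where B=B]) auto
  qed
  then show ?thesis by (auto simp: E_space_def)
qed

lemma subspace_F: "lin_subspace P F"
  unfolding F_space_def using RN_class_in_L0 by (intro lin_subspace_lin_span) auto

lemma F_L0: "w \<in> F \<Longrightarrow> w \<in> L0 P"
  using subspace_F by (auto simp: lin_subspace_def)

lemma RN_class_in_F: "Q \<in> M \<Longrightarrow> RN_class P Q \<in> F"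
  unfolding F_space_def using lin_span_superset by fast

text \<open>For fixed \<open>z\<close>, the classes whose product with \<open>z\<close> is
  integrable form a subspace containing R(M), hence also the span F.\<close>

lemma integrable_pairing:
  assumes z: "z \<in> E" and w: "w \<in> F"
  shows "integrable P (\<lambda>\<omega>. rep z \<omega> * rep w \<omega>)"
proof -
  let ?V = "{w \<in> L0 P. integrable P (\<lambda>\<omega>. rep w \<omega> * rep z \<omega>)}"
  have zL: "z \<in> L0 P" using z by (rule E_L0)
  have "lin_subspace P ?V"
    unfolding lin_subspace_def
  proof (intro conjI ballI allI)
    have "integrable P (\<lambda>\<omega>. rep (L0_zero P) \<omega> * rep z \<omega>)"
      by (rule integrable_cong_AE_imp[of P "\<lambda>_. 0"])
        (use rep_L0(1)[OF zL] rep_L0(1)[OF L0_zero_in_L0[of P]] AE_rep_zero[of P] in auto)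
    then show "L0_zero P \<in> ?V" by simp
  qed (auto simp: zL intro!: integrable_add_left integrable_scale_left)
  moreover have "RN_class P ` M \<subseteq> ?V"
    using z RN_class_in_L0 by (auto simp: E_iff mult.commute)
  ultimately have "F \<subseteq> ?V" unfolding F_space_def by (rule lin_span_minimal)
  with w show ?thesis by (auto simp: mult.commute)
qed

lemma pairing_linear:
  assumes "z \<in> E" "z' \<in> E" "w \<in> F" "w' \<in> F"
  shows "pairing P (L0_add P z z') w = pairing P z w + pairing P z' w"
    and "pairing P (L0_scale P c z) w = c * pairing P z w"
    and "pairing P z (L0_add P w w') = pairing P z w + pairing P z w'"
    and "pairing P z (L0_scale P c w) = c * pairing P z w"
proof -
  have int: "integrable P (\<lambda>\<omega>. rep v \<omega> * rep z \<omega>)" if "v \<in> F" for v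
    using integrable_pairing[OF assms(1) that] by (simp add: mult.commute)
  note L0 = assms(1,2)[THEN E_L0] assms(3,4)[THEN F_L0]
  show "pairing P (L0_add P z z') w = pairing P z w + pairing P z' w"
    "pairing P (L0_scale P c z) w = c * pairing P z w"
    using assms by (auto intro!: pairing_add_left pairing_scale_left integrable_pairing L0)
  show "pairing P z (L0_add P w w') = pairing P z w + pairing P z w'"
    "pairing P z (L0_scale P c w) = c * pairing P z w"
    unfolding pairing_commute[of P z] using assms
    by (auto intro!: pairing_add_left pairing_scale_left int L0)
qed

section \<open>Closures of wedges as bipolars\<close>

lemma closure_of_wedge_E:
  assumes C: "wedge P C" "C \<subseteq> E"
  shows "sigma_EF P M closure_of C = polar_E P M (polar_F P M C)"
proof -
  have "sigma_EF P M closure_of C = {x \<in> E. \<forall>y\<in>F. (\<forall>c\<in>C. pairing P c y \<le> 0) \<longrightarrow> pairing P x y \<le> 0}"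
    unfolding sigma_EF_def
  proof (rule weak_bipolar)
    have "L0_zero P \<in> F" using subspace_F by (simp add: lin_subspace_def)
    then show "\<exists>w\<in>F. \<forall>x\<in>E. pairing P x w = 0"
      using pairing_zero_left pairing_commute by metis
  next
    fix u v assume "u \<in> C" "v \<in> C"
    then show "\<exists>w\<in>C. \<forall>y\<in>F. pairing P w y = pairing P u y + pairing P v y"
      using C wedge_add by (intro bexI[of _ "L0_add P u v"]) (auto simp: pairing_linear subset_iff)
  next
    fix c v assume "0 \<le> (c::real)" "v \<in> C"
    then show "\<exists>w\<in>C. \<forall>y\<in>F. pairing P w y = c * pairing P v y"
      using C by (intro bexI[of _ "L0_scale P c v"]) (auto simp: pairing_linear subset_iff wedge_def)
  next
    fix u v assume "u \<in> F" "v \<in> F"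
    then show "\<exists>w\<in>F. \<forall>x\<in>E. pairing P x w = pairing P x u + pairing P x v"
      using subspace_F by (intro bexI[of _ "L0_add P u v"]) (auto simp: pairing_linear lin_subspace_def)
  next
    fix c v assume "v \<in> F"
    then show "\<exists>w\<in>F. \<forall>x\<in>E. pairing P x w = c * pairing P x v"
      using subspace_F by (intro bexI[of _ "L0_scale P c v"]) (auto simp: pairing_linear lin_subspace_def)
  qed (use C in \<open>auto simp: wedge_def\<close>)
  then show ?thesis by (auto simp: polar_E_def polar_F_def)
qed

lemma closure_of_wedge_F:
  assumes C: "wedge P C" "C \<subseteq> F"
  shows "sigma_FE P M closure_of C = polar_F P M (polar_E P M C)"
proof -
  have "sigma_FE P M closure_of C = {x \<in> F. \<forall>y\<in>E. (\<forall>c\<in>C. pairing P y c \<le> 0) \<longrightarrow> pairing P y x \<le> 0}"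
    unfolding sigma_FE_def
  proof (rule weak_bipolar)
    have "L0_zero P \<in> E" using subspace_E by (simp add: lin_subspace_def)
    then show "\<exists>z\<in>E. \<forall>x\<in>F. pairing P z x = 0"
      using pairing_zero_left by metis
  next
    fix u v assume "u \<in> C" "v \<in> C"
    then show "\<exists>w\<in>C. \<forall>y\<in>E. pairing P y w = pairing P y u + pairing P y v"
      using C wedge_add by (intro bexI[of _ "L0_add P u v"]) (auto simp: pairing_linear subset_iff)
  next
    fix c v assume "0 \<le> (c::real)" "v \<in> C"
    then show "\<exists>w\<in>C. \<forall>y\<in>E. pairing P y w = c * pairing P y v"
      using C by (intro bexI[of _ "L0_scale P c v"]) (auto simp: pairing_linear subset_iff wedge_def)
  next
    fix u v assume "u \<in> E" "v \<in> E"
    then show "\<exists>w\<in>E. \<forall>x\<in>F. pairing P w x = pairing P u x + pairing P v x"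
      using subspace_E by (intro bexI[of _ "L0_add P u v"]) (auto simp: pairing_linear lin_subspace_def)
  next
    fix c v assume "v \<in> E"
    then show "\<exists>w\<in>E. \<forall>x\<in>F. pairing P w x = c * pairing P v x"
      using subspace_E by (intro bexI[of _ "L0_scale P c v"]) (auto simp: pairing_linear lin_subspace_def)
  qed (use C in \<open>auto simp: wedge_def\<close>)
  then show ?thesis by (auto simp: polar_E_def polar_F_def)
qed

section \<open>The wedge s_E(K) and its polar\<close>

lemma s_E_iff: "x \<in> s_E P M K \<longleftrightarrow> x \<in> E \<and> (\<exists>g\<in>K. AE \<omega> in P. rep x \<omega> \<le> rep g \<omega>)"
  by (simp add: s_E_alt[OF M_ne M_sub] L0_le_def)

lemma K_s_E: "K \<subseteq> s_E P M K"
proof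
  fix g assume g: "g \<in> K"
  then have "\<exists>g'\<in>K. AE \<omega> in P. rep g \<omega> \<le> rep g' \<omega>" by (intro bexI[of _ g]) auto
  with g K_E show "g \<in> s_E P M K" by (auto simp: s_E_iff)
qed

text \<open>The wedge \<open>K\<close> contains 0, so s_E(K) contains the whole negative cone of E;
  this is what makes the polar consist of nonnegative classes.\<close>

lemma nonpos_in_s_E:
  assumes "x \<in> E" "AE \<omega> in P. rep x \<omega> \<le> 0"
  shows "x \<in> s_E P M K"
proof -
  have "AE \<omega> in P. rep x \<omega> \<le> rep (L0_zero P) \<omega>"
    using assms(2) AE_rep_zero[of P] by auto
  with assms(1) wedge_zero[OF wedge_K] show ?thesis by (auto simp: s_E_iff)
qed

lemma wedge_s_E: "wedge P (s_E P M K)"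
proof (rule wedgeI)
  have KL: "g \<in> L0 P" if "g \<in> K" for g using that K_E E_L0 by blast
  show "s_E P M K \<subseteq> L0 P" using E_L0 by (auto simp: s_E_iff)
  show "s_E P M K \<noteq> {}" using K_s_E wedge_K by (auto simp: wedge_def)
  fix x assume x: "x \<in> s_E P M K"
  then obtain g where g: "x \<in> E" "g \<in> K" "AE \<omega> in P. rep x \<omega> \<le> rep g \<omega>"
    by (auto simp: s_E_iff)
  {
    fix y assume "y \<in> s_E P M K"
    then obtain h where h: "y \<in> E" "h \<in> K" "AE \<omega> in P. rep y \<omega> \<le> rep h \<omega>"
      by (auto simp: s_E_iff)
    have "AE \<omega> in P. rep (L0_add P x y) \<omega> \<le> rep (L0_add P g h) \<omega>"
      using g(3) h(3) AE_rep_add[of x P y] AE_rep_add[of g P h] E_L0 KL g h by auto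
    moreover have "L0_add P x y \<in> E" using g h subspace_E by (auto simp: lin_subspace_def)
    ultimately show "L0_add P x y \<in> s_E P M K"
      using wedge_add[OF wedge_K] g h by (auto simp: s_E_iff)
  }
  fix c :: real assume c: "0 \<le> c"
  have "AE \<omega> in P. rep (L0_scale P c x) \<omega> \<le> rep (L0_scale P c g) \<omega>"
    using g(3) AE_rep_scale[OF E_L0[OF g(1)], of c] AE_rep_scale[OF KL[OF g(2)], of c]
    by eventually_elim (simp add: c mult_left_mono)
  moreover have "L0_scale P c x \<in> E" using g subspace_E by (auto simp: lin_subspace_def)
  moreover have "L0_scale P c g \<in> K" using wedge_K g c by (auto simp: wedge_def)
  ultimately show "L0_scale P c x \<in> s_E P M K" by (auto simp: s_E_iff)
qed

text \<open>The bilinearity rules for E and F do not cover densities from M_1 that lie outside F.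
  Integrability against \<open>K\<close> is therefore built into \<open>?W\<close>, which then is a
  wedge containing R(M_1).\<close>

lemma wedge_hull_M1_bound:
  assumes "w \<in> wedge_hull P (RN_class P ` M1 P K)"
  shows "AE \<omega> in P. 0 \<le> rep w \<omega>" and "\<And>g. g \<in> K \<Longrightarrow> pairing P g w \<le> 0"
proof -
  let ?W = "{w \<in> L0 P. (AE \<omega> in P. 0 \<le> rep w \<omega>) \<and>
    (\<forall>g\<in>K. integrable P (\<lambda>\<omega>. rep w \<omega> * rep g \<omega>) \<and> pairing P w g \<le> 0)}"
  have KL: "g \<in> L0 P" if "g \<in> K" for g using that K_E E_L0 by blast
  have RN: "RN_class P ` M1 P K \<subseteq> ?W"
  proof clarify
    fix Q assume Q: "Q \<in> M1 P K"
    then have ac: "ac_prob P Q" by (simp add: M1_def)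
    have "AE \<omega> in P. 0 \<le> rep (RN_class P Q) \<omega>" using AE_rep_RN_class[of P Q] by auto
    moreover have "integrable P (\<lambda>\<omega>. rep (RN_class P Q) \<omega> * rep g \<omega>)"
      "pairing P (RN_class P Q) g \<le> 0" if "g \<in> K" for g
      using Q that rep_RN_class_integral[OF prob_space_axioms ac KL[OF that]]
      by (auto simp: M1_def L1_def mult.commute pairing_commute[of P _ g])
    ultimately show "RN_class P Q \<in> L0 P \<and> (AE \<omega> in P. 0 \<le> rep (RN_class P Q) \<omega>) \<and>
      (\<forall>g\<in>K. integrable P (\<lambda>\<omega>. rep (RN_class P Q) \<omega> * rep g \<omega>) \<and> pairing P (RN_class P Q) g \<le> 0)"
      using RN_class_in_L0 by blast
  qed
  have "wedge P ?W"
  proof (rule wedgeI)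
    show "?W \<noteq> {}" using RN M_ne M_sub by blast
  next
    fix x y assume x: "x \<in> ?W" and y: "y \<in> ?W"
    have "AE \<omega> in P. 0 \<le> rep (L0_add P x y) \<omega>"
      using x y AE_rep_add[of x P y] by auto
    with x y show "L0_add P x y \<in> ?W"
      using KL by (auto simp: pairing_add_left intro!: integrable_add_left add_nonpos_nonpos)
  next
    fix c :: real and x assume c: "0 \<le> c" and x: "x \<in> ?W"
    have "AE \<omega> in P. 0 \<le> rep (L0_scale P c x) \<omega>"
      using x c AE_rep_scale[of x P c] by auto
    with x c show "L0_scale P c x \<in> ?W"
      using KL by (auto simp: pairing_scale_left mult_nonneg_nonpos intro!: integrable_scale_left)
  qed auto
  then have "w \<in> ?W" using wedge_hull_minimal[OF _ RN] assms by blast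
  then show "AE \<omega> in P. 0 \<le> rep w \<omega>" "\<And>g. g \<in> K \<Longrightarrow> pairing P g w \<le> 0"
    by (auto simp: pairing_commute[of P _ w])
qed

text \<open>Against the chosen test class the pairing is the integral of the negative part of
  \<open>w\<close>. It is nonnegative by itself and nonpositive by polarity, so the negative part
  vanishes almost everywhere.\<close>

lemma polar_F_s_E_nonneg:
  assumes w: "w \<in> polar_F P M (s_E P M K)"
  shows "AE \<omega> in P. 0 \<le> rep w \<omega>"
proof -
  have wF: "w \<in> F" and polar: "\<And>z. z \<in> s_E P M K \<Longrightarrow> pairing P z w \<le> 0"
    using w by (auto simp: polar_F_def)
  note [measurable] = rep_L0(1)[OF F_L0[OF wF]]
  define X where "X = (\<lambda>\<omega>. if rep w \<omega> < 0 then -1 else 0 :: real)"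
  have X[measurable]: "X \<in> borel_measurable P" unfolding X_def by measurable
  have E: "cls P X \<in> E" by (rule bounded_in_E[OF X, of 1]) (simp add: X_def)
  note [measurable] = rep_L0(1)[OF E_L0[OF E]]
  have "cls P X \<in> s_E P M K"
    using rep_cls[OF X] by (intro nonpos_in_s_E[OF E]) (auto simp: X_def)
  then have "pairing P (cls P X) w \<le> 0" by (rule polar)
  moreover have AE: "AE \<omega> in P. rep (cls P X) \<omega> * rep w \<omega> = (if rep w \<omega> < 0 then - rep w \<omega> else 0)"
    using rep_cls[OF X] by eventually_elim (simp add: X_def)
  then have nonneg: "AE \<omega> in P. 0 \<le> rep (cls P X) \<omega> * rep w \<omega>"
    by eventually_elim auto
  ultimately have "pairing P (cls P X) w = 0"
    unfolding pairing_def by (intro antisym integral_nonneg_AE)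
  then have "AE \<omega> in P. rep (cls P X) \<omega> * rep w \<omega> = 0"
    unfolding pairing_def
    by (subst (asm) integral_nonneg_eq_0_iff_AE[OF integrable_pairing[OF E wF] nonneg])
  with AE show ?thesis by eventually_elim (auto split: if_splits)
qed

lemma polar_F_s_E: "polar_F P M (s_E P M K) = F \<inter> wedge_hull P (RN_class P ` M1 P K)"
proof (intro equalityI subsetI)
  fix w assume w: "w \<in> polar_F P M (s_E P M K)"
  then have wF: "w \<in> F" and polar: "\<And>z. z \<in> s_E P M K \<Longrightarrow> pairing P z w \<le> 0"
    by (auto simp: polar_F_def)
  have wL: "w \<in> L0 P" using wF by (rule F_L0)
  note [measurable] = rep_L0(1)[OF wL]
  have nn: "AE \<omega> in P. 0 \<le> rep w \<omega>" using w by (rule polar_F_s_E_nonneg)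
  let ?H = "wedge_hull P (RN_class P ` M1 P K)"
  have H: "wedge P ?H"
    using M_ne M_sub RN_class_in_L0 by (intro wedge_wedge_hull) auto
  \<comment> \<open>Pairing with the constant 1 shows that \<open>w\<close> is
    \<open>P\<close>-integrable, so its mass \<open>m\<close> is meaningful.\<close>
  have one: "cls P (\<lambda>_. 1) \<in> E" by (rule bounded_in_E[of _ 1]) auto
  have int: "integrable P (rep w)"
    by (rule integrable_cong_AE_imp[OF integrable_pairing[OF one wF]])
      (use rep_cls[of "\<lambda>_. 1" P] in auto)
  define m where "m = (\<integral>\<omega>. rep w \<omega> \<partial>P)"
  have "0 \<le> m" unfolding m_def using nn by (rule integral_nonneg_AE)
  have "w \<in> ?H"
  proof (cases "m = 0")
    \<comment> \<open>Mass 0 cannot be normalized, but then \<open>w\<close> is zero, which belongs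
      to every wedge.\<close>
    case True
    then have "AE \<omega> in P. rep w \<omega> = 0"
      using integral_nonneg_eq_0_iff_AE[OF int nn] by (simp add: m_def)
    then have "AE \<omega> in P. rep w \<omega> = rep (L0_zero P) \<omega>" using AE_rep_zero[of P] by auto
    then have "w = L0_zero P" using wL by (intro L0_eqI) auto
    then show ?thesis using wedge_zero[OF H] by simp
  next
    case False
    with \<open>0 \<le> m\<close> have m: "0 < m" by simp
    define v where "v = L0_scale P (1 / m) w"
    have vF: "v \<in> F" using wF subspace_F by (auto simp: v_def lin_subspace_def)
    have vL: "v \<in> L0 P" using vF by (rule F_L0)
    note [measurable] = rep_L0(1)[OF vL]
    have AEv: "AE \<omega> in P. rep v \<omega> = (1 / m) * rep w \<omega>"
      unfolding v_def using wL by (rule AE_rep_scale)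
    have nnv: "AE \<omega> in P. 0 \<le> rep v \<omega>" using AEv nn m by auto
    have "(\<integral>\<omega>. rep v \<omega> \<partial>P) = (\<integral>\<omega>. (1 / m) * rep w \<omega> \<partial>P)"
      using AEv by (intro integral_cong_AE) auto
    also have "\<dots> = 1" using m by (simp add: m_def)
    finally have int1: "(\<integral>\<omega>. rep v \<omega> \<partial>P) = 1" .
    define Q where "Q = density P (rep v)"
    have ac: "ac_prob P Q" and RN: "RN_class P Q = v"
      unfolding Q_def by (rule RN_class_density[OF prob_space_axioms vL nnv int1])+
    have "g \<in> L1 P Q \<and> (\<integral>\<omega>. rep g \<omega> \<partial>Q) \<le> 0" if g: "g \<in> K" for g
    proof -
      have gE: "g \<in> E" using g K_E by blast
      have "pairing P g v = (1 / m) * pairing P g w"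
        unfolding v_def by (rule pairing_linear(4)[OF gE gE wF wF])
      also have "\<dots> \<le> 0"
        using polar[of g] g K_s_E m by (intro mult_nonneg_nonpos) auto
      finally show ?thesis
        using integrable_pairing[OF gE vF]
          rep_RN_class_integral[OF prob_space_axioms ac E_L0[OF gE]] E_L0[OF gE]
        by (simp add: RN L1_def)
    qed
    then have "Q \<in> M1 P K" using ac by (auto simp: M1_def)
    then have "v \<in> ?H" using wedge_hull_superset RN by fast
    \<comment> \<open>The normalization by 1/m is undone inside the wedge.\<close>
    then have "L0_scale P m v \<in> ?H" using H m by (simp add: wedge_def)
    moreover have "L0_scale P m v = w"
    proof (rule L0_eqI)
      show "AE \<omega> in P. rep (L0_scale P m v) \<omega> = rep w \<omega>"
        using AE_rep_scale[OF vL, of m] AEv by eventually_elim (use m in simp)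
    qed (use vL wL in auto)
    ultimately show ?thesis by simp
  qed
  with wF show "w \<in> F \<inter> ?H" by simp
next
  fix w assume w: "w \<in> F \<inter> wedge_hull P (RN_class P ` M1 P K)"
  then have wF: "w \<in> F" by simp
  note bound = wedge_hull_M1_bound[of w]
  have "pairing P z w \<le> 0" if z: "z \<in> s_E P M K" for z
  proof -
    obtain g where g: "z \<in> E" "g \<in> K" "AE \<omega> in P. rep z \<omega> \<le> rep g \<omega>"
      using z by (auto simp: s_E_iff)
    have "AE \<omega> in P. rep z \<omega> * rep w \<omega> \<le> rep g \<omega> * rep w \<omega>"
      using g(3) bound(1) w by (auto intro: mult_right_mono)
    \<comment> \<open>Here \<open>w\<close> must lie in F: this makes its product with
      \<open>z\<close> integrable, which being in W(R(M_1)) alone does not guarantee.\<close>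
    then have "pairing P z w \<le> pairing P g w"
      unfolding pairing_def using g K_E wF by (intro integral_mono_AE integrable_pairing) auto
    also have "\<dots> \<le> 0" using bound(2) w g(2) by blast
    finally show ?thesis .
  qed
  with wF show "w \<in> polar_F P M (s_E P M K)" by (simp add: polar_F_def)
qed

section \<open>Polars of the two closures and the equivalences\<close>

lemma c_E_eq: "c_E P M K = polar_E P M (polar_F P M (s_E P M K))"
  unfolding c_E_def using wedge_s_E by (rule closure_of_wedge_E) (auto simp: s_E_iff)

text \<open>Three successive polars reduce to one.\<close>

lemma polar_F_c_E: "polar_F P M (c_E P M K) = polar_F P M (s_E P M K)"
  unfolding c_E_eq by (auto simp: polar_E_def polar_F_def s_E_iff)

text \<open>For fixed \<open>z\<close>, the half-space of all \<open>w\<close> in F with nonpositive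
  pairing is itself a wedge, so it contains the hull as soon as it contains the generators.\<close>

lemma polar_E_wedge_hull:
  "polar_E P M (wedge_hull P (RN_class P ` M)) = polar_E P M (RN_class P ` M)"
proof
  show "polar_E P M (RN_class P ` M) \<subseteq> polar_E P M (wedge_hull P (RN_class P ` M))"
  proof
    fix z assume z: "z \<in> polar_E P M (RN_class P ` M)"
    then have zE: "z \<in> E" by (simp add: polar_E_def)
    have "wedge P {w \<in> F. pairing P z w \<le> 0}"
    proof (rule wedgeI)
      show "{w \<in> F. pairing P z w \<le> 0} \<noteq> {}"
        using z M_ne RN_class_in_F by (auto simp: polar_E_def)
    qed (use F_L0 subspace_F zE in \<open>auto simp: lin_subspace_def pairing_linear mult_nonneg_nonpos\<close>)
    then have "wedge_hull P (RN_class P ` M) \<subseteq> {w \<in> F. pairing P z w \<le> 0}"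
      using z RN_class_in_F by (intro wedge_hull_minimal) (auto simp: polar_E_def)
    with zE show "z \<in> polar_E P M (wedge_hull P (RN_class P ` M))" by (auto simp: polar_E_def)
  qed
  show "polar_E P M (wedge_hull P (RN_class P ` M)) \<subseteq> polar_E P M (RN_class P ` M)"
    using wedge_hull_superset[of "RN_class P ` M" P] by (auto simp: polar_E_def)
qed

lemma closure_of_wedge_hull:
  "sigma_FE P M closure_of wedge_hull P (RN_class P ` M)
    = polar_F P M (polar_E P M (RN_class P ` M))"
proof -
  have "wedge P (wedge_hull P (RN_class P ` M))"
    using M_ne RN_class_in_L0 by (intro wedge_wedge_hull) auto
  moreover have "wedge_hull P (RN_class P ` M) \<subseteq> F"
    using RN_class_in_F by (intro wedge_hull_minimal lin_subspace_imp_wedge subspace_F) auto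
  ultimately show ?thesis
    by (simp add: closure_of_wedge_F polar_E_wedge_hull)
qed

lemma polar_E_polar_F_polar_E:
  "B \<subseteq> F \<Longrightarrow> polar_E P M (polar_F P M (polar_E P M B)) = polar_E P M B"
  by (auto simp: polar_E_def polar_F_def)

text \<open>The closure is the polar of the polar of R(M). Applying the polar in E to the left
  equation turns it into the right one by the triple-polar identity; applying the polar in F to the
  right one leads back.\<close>

lemma closure_of_wedge_hull_iff:
  "sigma_FE P M closure_of wedge_hull P (RN_class P ` M) = polar_F P M (s_E P M K)
    \<longleftrightarrow> polar_E P M (RN_class P ` M) = c_E P M K"
proof -
  have "RN_class P ` M \<subseteq> F" using RN_class_in_F by auto
  then show ?thesis
    unfolding closure_of_wedge_hull
    by (metis c_E_eq polar_F_c_E polar_E_polar_F_polar_E)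
qed

end

theorem theorem5p3:
  fixes P :: "'a measure"
    and K :: "('a \<Rightarrow> real) set set"
    and M :: "'a measure set"
  assumes "prob_space P"
    and "wedge P K"
    and "M \<noteq> {}"
    and "M \<subseteq> M1 P K"
  shows
    "(sigma_FE P M closure_of wedge_hull P (RN_class P ` M)
        = F_space P M \<inter> wedge_hull P (RN_class P ` M1 P K)
      \<longleftrightarrow> polar_E P M (RN_class P ` M) = c_E P M K)
     \<and>
     (polar_E P M (RN_class P ` M) = c_E P M K
      \<longleftrightarrow> sigma_FE P M closure_of wedge_hull P (RN_class P ` M) = polar_F P M (c_E P M K)
          \<and> polar_F P M (c_E P M K) = polar_F P M (s_E P M K))"
proof -
  interpret wedge_duality P K M
    using assms by (simp add: wedge_duality_def wedge_duality_axioms_def)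
  show ?thesis
    using closure_of_wedge_hull_iff polar_F_s_E polar_F_c_E by simp
qed

end
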